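(* Let $0<p_{\min}<p_{\max}$, $\theta=p_{\max}/p_{\min}$, and $$\alpha=\left(W\!\left(-\frac{\theta-1}{\theta\, e}\right)+1\right)^{-1},$$ where $W$ is the (principal branch of the) Lambert-$W$ function, the inverse of $z\mapsto z e^{z}$. Run the algorithm BatMan (described in the context) with the reservation function $$G_{B'}(p)=\alpha B'\ln\!\left[\left(1-\frac{p}{p_{\max}}\right)\frac{\alpha}{\alpha-1}\right],\quad p\in\left[p_{\min},\frac{p_{\max}}{\alpha}\right],$$ (and $G_{B'}(p)=0$ for $p\ge p_{\max}/\alpha$). Then BatMan is $\alpha$-competitive for the online inventory problem without rate constraints, and $\alpha$ is the optimal competitive ratio: no online algorithm for this problem is $c$-competitive with $c<\alpha$.
   Context: Online inventory problem (without rate constraints). Time slots $t=1,\dots,T$. At each slot $t$ a price $p(t)\in[p_{\min},p_{\max}]$ and a demand $d(t)\ge 0$ are revealed, where $0<p_{\min}<p_{\max}$ are known in advance. The decision maker chooses a procurement amount $x(t)\ge 0$; the inventory level evolves as $b(t)=b(t-1)+x(t)-d(t)$ with $b(0)=0$. Feasibility requires $x(t)\ge d(t)-b(t-1)$ and $0\le b(t)\le B$ for all $t$, where $B>0$ is the inventory capacity. The cost is $\sum_t p(t)x(t)$. An online algorithm chooses $x(t)$ knowing only $p(1),\dots,p(t)$ and $d(1),\dots,d(t)$. For an instance $\omega=(p(t),d(t))_{t=1}^T$, $\mathrm{cost}_\omega(\mathrm{OPT})$ denotes the minimum cost of a feasible solution (the offline optimum). An online algorithm $A$ is $c$-competitive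 if there is a constant $\mathrm{cons}\ge 0$, independent of $\omega$, such that $\mathrm{cost}_\omega(A)\le c\cdot \mathrm{cost}_\omega(\mathrm{OPT})+\mathrm{cons}$ for every instance $\omega$. Algorithm BatMan. It maintains "virtual storages" $i=1,\dots,v$ with capacities $B_i$ and reservation prices $\xi_i$. Initially $v=1$, $B_1=B$, $\xi_1=p_{\max}/\alpha$. At each slot $t$: (1) if $d(t)>0$, set $v\leftarrow v+1$, $B_v\leftarrow d(t)$, $\xi_v\leftarrow p_{\max}/\alpha$; (2) for every $i\le v$ set $x_i(t)=[G_{B_i}(p(t))-G_{B_i}(\xi_i)]^+$ and then $\xi_i\leftarrow\min\{p(t),\xi_i\}$; (3) set $x(t)=\max\{\sum_{i=1}^v x_i(t),\,[d(t)-b(t-1)]^+\}$ and $b(t)=b(t-1)+x(t)-d(t)$; (4) if $b(t)=0$, reset $v\leftarrow 1$ and $\xi_1\leftarrow p_{\max}/\alpha$ (all other virtual storages are discarded). *)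

theory Defs
  imports "HOL-Analysis.Analysis"
begin

text \<open>Principal branch: the inverse of \<open>w \<mapsto> w e\<^sup>w\<close> on its increasing part \<open>{-1..}\<close>
  (meaningful for arguments at least \<open>-1/e\<close>).\<close>

definition Lambert_W :: "real \<Rightarrow> real" where
  "Lambert_W = inv_into {-1..} (\<lambda>w. w * exp w)"

text \<open>A problem input is the list \<open>[(p(1), d(1)), \<dots>, (p(T), d(T))]\<close>; its length is the horizon.
  Times are 1-based, as are the arguments of \<open>price\<close>, \<open>demand\<close> and of procurement plans.\<close>

type_synonym slot = "real \<times> real"

definition price :: "slot list \<Rightarrow> nat \<Rightarrow> real" where
  "price \<omega> t = fst (\<omega> ! (t - 1))"

definition demand :: "slot list \<Rightarrow> nat \<Rightarrow> real" where
  "demand \<omega> t = snd (\<omega> ! (t - 1))"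

definition valid_input :: "real \<Rightarrow> real \<Rightarrow> slot list \<Rightarrow> bool" where
  "valid_input pmin pmax \<omega> \<longleftrightarrow>
     (\<forall>t\<in>{1..length \<omega>}. price \<omega> t \<in> {pmin..pmax} \<and> demand \<omega> t \<ge> 0)"

primrec inventory :: "slot list \<Rightarrow> (nat \<Rightarrow> real) \<Rightarrow> nat \<Rightarrow> real" where
  "inventory \<omega> x 0 = 0"
| "inventory \<omega> x (Suc t) = inventory \<omega> x t + x (Suc t) - demand \<omega> (Suc t)"

definition feasible :: "real \<Rightarrow> slot list \<Rightarrow> (nat \<Rightarrow> real) \<Rightarrow> bool" where
  "feasible B \<omega> x \<longleftrightarrow>
     (\<forall>t\<in>{1..length \<omega>}. x t \<ge> 0 \<and> x t \<ge> demand \<omega> t - inventory \<omega> x (t - 1)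
        \<and> 0 \<le> inventory \<omega> x t \<and> inventory \<omega> x t \<le> B)"

definition cost :: "slot list \<Rightarrow> (nat \<Rightarrow> real) \<Rightarrow> real" where
  "cost \<omega> x = (\<Sum>t = 1..length \<omega>. price \<omega> t * x t)"

text \<open>For a valid input the infimum is a minimum: only \<open>x 1, \<dots>, x T\<close> matter, and the feasible
  ones form a nonempty compact set (\<open>x t = demand \<omega> t\<close> is feasible).\<close>

definition opt_cost :: "real \<Rightarrow> slot list \<Rightarrow> real" where
  "opt_cost B \<omega> = Inf {cost \<omega> x | x. feasible B \<omega> x}"

text \<open>A (deterministic) online algorithm maps the history \<open>[(p(1), d(1)), \<dots>, (p(t), d(t))]\<close>
  to the amount \<open>x(t)\<close>; in particular it does not know the horizon.\<close>

type_synonym policy = "slot list \<Rightarrow> real"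

definition decisions :: "policy \<Rightarrow> slot list \<Rightarrow> nat \<Rightarrow> real" where
  "decisions A \<omega> t = A (take t \<omega>)"

definition online_algorithm :: "real \<Rightarrow> real \<Rightarrow> real \<Rightarrow> policy \<Rightarrow> bool" where
  "online_algorithm pmin pmax B A \<longleftrightarrow>
     (\<forall>\<omega>. valid_input pmin pmax \<omega> \<longrightarrow> feasible B \<omega> (decisions A \<omega>))"

definition competitive :: "real \<Rightarrow> real \<Rightarrow> real \<Rightarrow> real \<Rightarrow> policy \<Rightarrow> bool" where
  "competitive pmin pmax B c A \<longleftrightarrow>
     (\<exists>cons\<ge>0. \<forall>\<omega>. valid_input pmin pmax \<omega> \<longrightarrow>
        cost \<omega> (decisions A \<omega>) \<le> c * opt_cost B \<omega> + cons)"

definition reservation :: "real \<Rightarrow> real \<Rightarrow> real \<Rightarrow> real \<Rightarrow> real" where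
  "reservation pmax \<alpha> B' p =
     (if p < pmax / \<alpha> then \<alpha> * B' * ln ((1 - p / pmax) * (\<alpha> / (\<alpha> - 1))) else 0)"

text \<open>State of BatMan: inventory level and the virtual storages \<open>(B\<^sub>i, \<xi>\<^sub>i)\<close>, \<open>i = 1, \<dots>, v\<close>.
  The parameter \<open>\<xi>0\<close> is the initial reservation price \<open>p\<^sub>m\<^sub>a\<^sub>x / \<alpha>\<close>.\<close>

type_synonym batman_state = "real \<times> (real \<times> real) list"

definition batman_init :: "real \<Rightarrow> real \<Rightarrow> batman_state" where
  "batman_init \<xi>0 B = (0, [(B, \<xi>0)])"

definition batman_step ::
  "(real \<Rightarrow> real \<Rightarrow> real) \<Rightarrow> real \<Rightarrow> real \<Rightarrow> batman_state \<Rightarrow> slot \<Rightarrow> real \<times> batman_state" where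
  "batman_step G \<xi>0 B s pd =
     (let (b, vs) = s;
          (p, d) = pd;
          vs' = (if d > 0 then vs @ [(d, \<xi>0)] else vs);
          x = max (\<Sum>(C, \<xi>)\<leftarrow>vs'. max 0 (G C p - G C \<xi>)) (max 0 (d - b));
          b' = b + x - d
      in (x, if b' = 0 then batman_init \<xi>0 B
             else (b', map (\<lambda>(C, \<xi>). (C, min p \<xi>)) vs')))"

definition batman_run ::
  "(real \<Rightarrow> real \<Rightarrow> real) \<Rightarrow> real \<Rightarrow> real \<Rightarrow> slot list \<Rightarrow> batman_state" where
  "batman_run G \<xi>0 B h = foldl (\<lambda>s pd. snd (batman_step G \<xi>0 B s pd)) (batman_init \<xi>0 B) h"

definition batman :: "(real \<Rightarrow> real \<Rightarrow> real) \<Rightarrow> real \<Rightarrow> real \<Rightarrow> policy" where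
  "batman G \<xi>0 B h = fst (batman_step G \<xi>0 B (batman_run G \<xi>0 B (butlast h)) (last h))"

end

theory Submission
  imports Defs
begin

text \<open>Upper bound: filling a virtual storage of capacity \<open>C\<close> down to price \<open>\<xi>\<close> and topping it up at
  price \<open>pmax\<close> costs at most \<open>\<alpha> * C * \<xi>\<close>. Taking as dual price at time \<open>t\<close> the final reservation
  price of a storage opened at \<open>t\<close>, the sum of the \<open>C * \<xi>\<close> over a phase (the time between two resets)
  exceeds the dual objective by at most \<open>B * pmax / \<alpha>\<close>, which pays for topping up the surplus
  capacity \<open>B\<close>.

  Lower bound: let prices descend from \<open>pmax / c\<close> to \<open>pmin\<close> without demand, stop at some price, then
  demand \<open>B\<close> at price \<open>pmax\<close>. Staying below ratio \<open>c\<close> at every stopping price forces purchases of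
  about \<open>c * B * ln ((pmax - pmin) / (pmax - pmax / c))\<close>, which is more than \<open>B\<close> if \<open>c < \<alpha>\<close>. Each
  repetition loses a fixed amount, which defeats any additive constant.\<close>

section \<open>Inputs, plans and costs when one slot is appended\<close>

lemma price_append: "t \<in> {1..length \<omega>} \<Longrightarrow> price (\<omega> @ \<rho>) t = price \<omega> t"
  and demand_append: "t \<in> {1..length \<omega>} \<Longrightarrow> demand (\<omega> @ \<rho>) t = demand \<omega> t"
  by (auto simp: price_def demand_def nth_append)

lemma price_snoc [simp]: "price (\<omega> @ [s]) (Suc (length \<omega>)) = fst s"
  and demand_snoc [simp]: "demand (\<omega> @ [s]) (Suc (length \<omega>)) = snd s"
  by (auto simp: price_def demand_def)

lemma inventory_cong:
  assumes "\<And>s. s \<in> {1..t} \<Longrightarrow> x s = x' s" and "\<And>s. s \<in> {1..t} \<Longrightarrow> demand \<omega> s = demand \<omega>' s"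
  shows "inventory \<omega> x t = inventory \<omega>' x' t"
  using assms by (induction t) auto

lemma inventory_append:
  "t \<le> length \<omega> \<Longrightarrow> inventory (\<omega> @ \<rho>) x t = inventory \<omega> x t"
  by (rule inventory_cong) (auto simp: demand_append)

lemma cost_snoc: "cost (\<omega> @ [s]) x = cost \<omega> x + fst s * x (Suc (length \<omega>))"
  by (simp add: cost_def price_append)

lemma atLeastAtMost_length_snoc:
  "{1..length (\<omega> @ [s])} = insert (Suc (length \<omega>)) {1..length \<omega>}"
  by auto

lemma valid_input_snoc:
  "valid_input pmin pmax (\<omega> @ [s]) \<longleftrightarrow>
     valid_input pmin pmax \<omega> \<and> fst s \<in> {pmin..pmax} \<and> 0 \<le> snd s"
  unfolding valid_input_def atLeastAtMost_length_snoc
  by (auto simp: price_append demand_append)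

lemma feasible_snoc:
  "feasible B (\<omega> @ [s]) x \<longleftrightarrow>
     feasible B \<omega> x \<and> 0 \<le> x (Suc (length \<omega>)) \<and>
     inventory \<omega> x (length \<omega>) + x (Suc (length \<omega>)) - snd s \<in> {0..B}"
proof -
  have "inventory (\<omega> @ [s]) x (t - 1) = inventory \<omega> x (t - 1)"
    and "inventory (\<omega> @ [s]) x t = inventory \<omega> x t" if "t \<in> {1..length \<omega>}" for t
    using that by (auto intro!: inventory_append)
  then show ?thesis
    unfolding feasible_def atLeastAtMost_length_snoc
    by (auto simp: demand_append inventory_append)
qed

lemma valid_input_Nil [simp]: "valid_input pmin pmax []"
  and feasible_Nil [simp]: "feasible B [] x"
  and cost_Nil [simp]: "cost [] x = 0"
  by (auto simp: valid_input_def feasible_def cost_def)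

lemma plan_cong:
  assumes "\<And>t. t \<in> {1..length \<omega>} \<Longrightarrow> x t = x' t"
  shows "cost \<omega> x = cost \<omega> x'"
    and "feasible B \<omega> x \<longleftrightarrow> feasible B \<omega> x'"
    and "t \<le> length \<omega> \<Longrightarrow> inventory \<omega> x t = inventory \<omega> x' t"
proof -
  have inv: "t \<le> length \<omega> \<Longrightarrow> inventory \<omega> x t = inventory \<omega> x' t" for t
    using assms by (intro inventory_cong) auto
  then show "t \<le> length \<omega> \<Longrightarrow> inventory \<omega> x t = inventory \<omega> x' t" .
  show "cost \<omega> x = cost \<omega> x'"
    using assms by (simp add: cost_def)
  have "inventory \<omega> x t = inventory \<omega> x' t" "inventory \<omega> x (t - 1) = inventory \<omega> x' (t - 1)"
    if "t \<in> {1..length \<omega>}" for t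
    using that by (auto intro!: inv)
  then show "feasible B \<omega> x \<longleftrightarrow> feasible B \<omega> x'"
    using assms unfolding feasible_def by auto
qed

text \<open>An online algorithm cannot revise the past, so a further slot leaves earlier purchases
  alone. This permits induction on the last slot.\<close>

lemma decisions_snoc:
  shows "decisions A (\<omega> @ [s]) (Suc (length \<omega>)) = A (\<omega> @ [s])"
    and "cost \<omega> (decisions A (\<omega> @ [s])) = cost \<omega> (decisions A \<omega>)"
    and "feasible B \<omega> (decisions A (\<omega> @ [s])) \<longleftrightarrow> feasible B \<omega> (decisions A \<omega>)"
    and "inventory \<omega> (decisions A (\<omega> @ [s])) (length \<omega>) = inventory \<omega> (decisions A \<omega>) (length \<omega>)"
proof -
  have "decisions A (\<omega> @ [s]) t = decisions A \<omega> t" if "t \<in> {1..length \<omega>}" for t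
    using that by (simp add: decisions_def)
  note plan_cong[OF this]
  then show "cost \<omega> (decisions A (\<omega> @ [s])) = cost \<omega> (decisions A \<omega>)"
    and "feasible B \<omega> (decisions A (\<omega> @ [s])) \<longleftrightarrow> feasible B \<omega> (decisions A \<omega>)"
    and "inventory \<omega> (decisions A (\<omega> @ [s])) (length \<omega>) = inventory \<omega> (decisions A \<omega>) (length \<omega>)"
    by auto
qed (simp add: decisions_def)

lemma feasible_inventory:
  assumes "feasible B \<omega> x" and "0 \<le> B"
  shows "inventory \<omega> x (length \<omega>) \<in> {0..B}"
  using assms by (cases \<omega> rule: rev_cases) (auto simp: feasible_snoc inventory_append)

lemma cost_nonneg:
  assumes "valid_input pmin pmax \<omega>" and "0 \<le> pmin" and "feasible B \<omega> x"
  shows "0 \<le> cost \<omega> x"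
  unfolding cost_def
proof (rule sum_nonneg)
  fix t assume "t \<in> {1..length \<omega>}"
  then have "pmin \<le> price \<omega> t" "0 \<le> x t"
    using assms unfolding valid_input_def feasible_def by (metis atLeastAtMost_iff)+
  then show "0 \<le> price \<omega> t * x t"
    using assms(2) by simp
qed

text \<open>Shows that the set under the infimum in \<open>opt_cost\<close> is nonempty.\<close>

lemma feasible_demand:
  assumes "valid_input pmin pmax \<omega>" and "0 \<le> B"
  shows "feasible B \<omega> (demand \<omega>)"
proof -
  have "inventory \<omega> (demand \<omega>) t = 0" for t
    by (induction t) auto
  then show ?thesis
    using assms by (auto simp: feasible_def valid_input_def)
qed

lemma opt_cost_le:
  assumes "valid_input pmin pmax \<omega>" and "0 \<le> pmin" and "feasible B \<omega> x"
  shows "opt_cost B \<omega> \<le> cost \<omega> x"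
  unfolding opt_cost_def using assms
  by (intro cInf_lower bdd_belowI[of _ 0]) (auto intro: cost_nonneg)

lemma opt_cost_ge:
  assumes "valid_input pmin pmax \<omega>" and "0 \<le> B" and "\<And>x. feasible B \<omega> x \<Longrightarrow> m \<le> cost \<omega> x"
  shows "m \<le> opt_cost B \<omega>"
  unfolding opt_cost_def using assms feasible_demand[OF assms(1,2)]
  by (intro cInf_greatest) auto

subsection \<open>The reservation function\<close>

text \<open>\<open>full\<close> is the defining equation of \<alpha> in exponential form: a virtual
  storage is exactly full once its reservation price has dropped to \<open>pmin\<close>.\<close>

locale batman_setting =
  fixes pmin pmax B \<alpha> :: real
  assumes pmin_pos: "0 < pmin" and B_pos: "0 < B" and \<alpha>_gt: "1 < \<alpha>"
    and pmin_less: "pmin < pmax / \<alpha>"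
    and full: "(1 - pmin / pmax) * (\<alpha> / (\<alpha> - 1)) = exp (1 / \<alpha>)"
begin

abbreviation "\<xi>0 \<equiv> pmax / \<alpha>"
abbreviation "G \<equiv> reservation pmax \<alpha>"

lemma pmax_pos: "0 < pmax"
proof -
  have "0 < pmax / \<alpha>" using pmin_pos pmin_less by linarith
  then show ?thesis using \<alpha>_gt by (simp add: zero_less_divide_iff)
qed

lemma \<xi>0_less: "\<xi>0 < pmax"
  using pmax_pos \<alpha>_gt by (simp add: field_simps)

lemma reservation_eq:
  assumes "\<xi> \<le> \<xi>0"
  shows "G C \<xi> = \<alpha> * C * (ln (pmax - \<xi>) - ln (pmax - \<xi>0))"
proof -
  have "(1 - \<xi> / pmax) * (\<alpha> / (\<alpha> - 1)) = (pmax - \<xi>) / (pmax - \<xi>0)"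
    using pmax_pos \<alpha>_gt by (simp add: field_simps)
  then show ?thesis
    using assms \<xi>0_less by (auto simp: reservation_def ln_div)
qed

lemma reservation_antimono:
  assumes "0 \<le> C" and "p \<le> \<xi>"
  shows "G C \<xi> \<le> G C p"
proof -
  have *: "G C (min \<zeta> \<xi>0) = G C \<zeta>" for \<zeta>
    by (auto simp: reservation_def min_def)
  have "ln (pmax - min \<xi> \<xi>0) \<le> ln (pmax - min p \<xi>0)"
    using assms \<xi>0_less by auto
  then have "G C (min \<xi> \<xi>0) \<le> G C (min p \<xi>0)"
    using assms \<alpha>_gt by (simp add: reservation_eq mult_left_mono)
  then show ?thesis by (simp add: *)
qed

lemma reservation_le:
  assumes "0 \<le> C" and "pmin \<le> \<xi>"
  shows "G C \<xi> \<le> C"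
proof -
  have "G C pmin = C"
    using pmin_less \<alpha>_gt unfolding reservation_def full by simp
  then show ?thesis
    using reservation_antimono[OF assms] by simp
qed

text \<open>Written as a difference, the purchases of one storage telescope to \<open>G\<close> at
  its current reservation price.\<close>

lemma purchase_eq:
  assumes "0 \<le> C"
  shows "max 0 (G C p - G C \<xi>) = G C (min p \<xi>) - G C \<xi>"
  using reservation_antimono[OF assms, of p \<xi>] reservation_antimono[OF assms, of \<xi> p]
  by (auto simp: min_def)

text \<open>\<open>G\<close> is chosen so that the cost of filling a storage of size \<open>C\<close> down to the reservation
  price \<open>\<xi>\<close> and topping it up at price \<open>pmax\<close> is \<open>\<alpha> * C * \<xi>\<close>.\<close>

lemma purchase_cost:
  assumes "0 \<le> C" and "\<xi> \<le> \<xi>0"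
  shows "p * max 0 (G C p - G C \<xi>)
    \<le> \<alpha> * (C * min p \<xi>) - \<alpha> * (C * \<xi>) + pmax * max 0 (G C p - G C \<xi>)"
proof (cases "p < \<xi>")
  case True
  define u where "u = pmax - p"
  define v where "v = pmax - \<xi>"
  have uv: "0 < v" "v < u"
    using True assms \<xi>0_less by (auto simp: u_def v_def)
  \<comment> \<open>The whole amount is bought at \<open>p\<close>, the lowest price of the drop, so
    relative to \<open>pmax\<close> it saves at least the integral
    \<open>\<alpha> * C * (u - v)\<close> of gradual buying; the tangent bound on \<open>ln\<close>
    expresses this.\<close>
  have "ln (v / u) \<le> v / u - 1"
    using uv by (intro ln_le_minus_one) auto
  then have "u * (1 - v / u) \<le> u * (ln u - ln v)"
    using uv by (intro mult_left_mono) (auto simp: ln_div)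
  then have "\<alpha> * C * (u - v) \<le> \<alpha> * C * (u * (ln u - ln v))"
    using uv assms \<alpha>_gt by (intro mult_left_mono) (auto simp: algebra_simps)
  moreover have "G C (min p \<xi>) - G C \<xi> = \<alpha> * C * (ln u - ln v)"
    using True assms by (simp add: reservation_eq u_def v_def algebra_simps)
  ultimately have "\<alpha> * C * (u - v) \<le> u * (G C (min p \<xi>) - G C \<xi>)"
    by (simp add: mult_ac)
  then show ?thesis
    using True assms by (simp add: purchase_eq u_def v_def algebra_simps)
next
  case False
  then show ?thesis by (simp add: assms purchase_eq)
qed

subsection \<open>One step of BatMan\<close>

text \<open>Part of the dual objective: \<open>q\<close> stands for the lowest price still to come,
  which pulls every larger reservation price down to it.\<close>

definition capped :: "(real \<times> real) list \<Rightarrow> real \<Rightarrow> real" where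
  "capped vs q = (\<Sum>(C, \<xi>)\<leftarrow>vs. C * min \<xi> q)"

text \<open>A storage with reservation price \<xi> holds \<open>G C \<xi>\<close>, so the last
  equation says that the free space of all virtual storages together is the free space
  \<open>B - b\<close> of the real one.\<close>

definition good_state :: "real \<Rightarrow> (real \<times> real) list \<Rightarrow> bool" where
  "good_state b vs \<longleftrightarrow> 0 \<le> b \<and> (\<forall>(C, \<xi>)\<in>set vs. 0 \<le> C \<and> pmin \<le> \<xi> \<and> \<xi> \<le> \<xi>0)
     \<and> b - B = (\<Sum>(C, \<xi>)\<leftarrow>vs. G C \<xi> - C)"

lemma sum_list_reservation_diff_nonpos:
  assumes "\<forall>(C, \<xi>)\<in>set vs. 0 \<le> C \<and> pmin \<le> \<xi> \<and> \<xi> \<le> \<xi>0"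
  shows "(\<Sum>(C, \<xi>)\<leftarrow>vs. G C \<xi> - C) \<le> 0"
  using assms by (intro sum_list_nonpos) (fastforce intro: reservation_le)

lemma good_state_le: "good_state b vs \<Longrightarrow> b \<le> B"
  using sum_list_reservation_diff_nonpos[of vs] by (auto simp: good_state_def)

lemma good_state_init: "good_state 0 [(B, \<xi>0)]"
  using B_pos pmin_less by (simp add: good_state_def reservation_def)

lemma storages_update:
  assumes "\<forall>(C, \<xi>)\<in>set vs. 0 \<le> C \<and> pmin \<le> \<xi> \<and> \<xi> \<le> \<xi>0" and "pmin \<le> p"
  defines "S \<equiv> (\<Sum>(C, \<xi>)\<leftarrow>vs. max 0 (G C p - G C \<xi>))"
    and "us \<equiv> map (\<lambda>(C, \<xi>). (C, min p \<xi>)) vs"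
  shows "\<forall>(C, \<xi>)\<in>set us. 0 \<le> C \<and> pmin \<le> \<xi> \<and> \<xi> \<le> \<xi>0"
    and "(\<Sum>(C, \<xi>)\<leftarrow>us. G C \<xi> - C) = (\<Sum>(C, \<xi>)\<leftarrow>vs. G C \<xi> - C) + S"
    and "capped us q = capped vs (min p q)"
    and "p * S \<le> \<alpha> * (capped us \<xi>0 - capped vs \<xi>0) + pmax * S"
    and "0 \<le> S"
proof -
  note defs = S_def us_def
  show "\<forall>(C, \<xi>)\<in>set us. 0 \<le> C \<and> pmin \<le> \<xi> \<and> \<xi> \<le> \<xi>0"
    using assms(1,2) by (auto simp: us_def)
  show "(\<Sum>(C, \<xi>)\<leftarrow>us. G C \<xi> - C) = (\<Sum>(C, \<xi>)\<leftarrow>vs. G C \<xi> - C) + S"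
    using assms(1) unfolding defs by (induction vs) (auto simp: purchase_eq)
  show "capped us q = capped vs (min p q)"
    unfolding defs capped_def by (induction vs) (auto simp: min.assoc min.left_commute)
  show "0 \<le> S"
    unfolding S_def by (intro sum_list_nonneg) auto
  show "p * S \<le> \<alpha> * (capped us \<xi>0 - capped vs \<xi>0) + pmax * S"
    using assms(1) unfolding defs
  proof (induction vs)
    case (Cons v vs)
    obtain C \<xi> where v: "v = (C, \<xi>)" by fastforce
    have "p * max 0 (G C p - G C \<xi>)
      \<le> \<alpha> * (C * min p \<xi>) - \<alpha> * (C * \<xi>) + pmax * max 0 (G C p - G C \<xi>)"
      using Cons.prems v by (intro purchase_cost) auto
    moreover have m: "min (min p \<xi>) \<xi>0 = min p \<xi>" "min \<xi> \<xi>0 = \<xi>"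
      using Cons.prems v by auto
    ultimately show ?case
      using Cons unfolding v capped_def by (simp add: m algebra_simps)
  qed (simp add: capped_def)
qed

text \<open>\<open>us\<close> lists the storages before a possible reset. Cost and dual value are
  compared on it; the reset is handled in the invariant.\<close>

lemma batman_step_good:
  assumes good: "good_state b vs" and p: "p \<in> {pmin..pmax}" and d: "0 \<le> d"
    and step: "batman_step G \<xi>0 B (b, vs) (p, d) = (x, (b', vs'))"
  obtains us where "good_state b' vs'"
    and "0 \<le> x" and "b' = b + x - d"
    and "p * x \<le> \<alpha> * (capped us \<xi>0 - capped vs \<xi>0) + pmax * (x - d)"
    and "\<And>q. q \<le> \<xi>0 \<Longrightarrow> capped us q = capped vs (min p q) + d * min p q"
    and "vs' = us \<or> vs' = [(B, \<xi>0)]"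
proof -
  define ws where "ws = (if d > 0 then vs @ [(d, \<xi>0)] else vs)"
  define S where "S = (\<Sum>(C, \<xi>)\<leftarrow>ws. max 0 (G C p - G C \<xi>))"
  define us where "us = map (\<lambda>(C, \<xi>). (C, min p \<xi>)) ws"
  have ws: "\<forall>(C, \<xi>)\<in>set ws. 0 \<le> C \<and> pmin \<le> \<xi> \<and> \<xi> \<le> \<xi>0"
    using good d pmin_less by (auto simp: good_state_def ws_def)
  have "pmin \<le> p" using p by simp
  note upd = storages_update[OF ws this, folded S_def us_def]
  have x: "x = max S (max 0 (d - b))" and b': "b' = b + x - d"
    and vs': "vs' = (if b' = 0 then [(B, \<xi>0)] else us)"
    using step unfolding batman_step_def S_def us_def ws_def
    by (auto simp: batman_init_def Let_def split: if_splits)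
  have capped_ws: "capped ws q = capped vs q + d * min \<xi>0 q" for q
    using d by (auto simp: ws_def capped_def)
  have G0: "G C \<xi>0 = 0" for C by (simp add: reservation_def)
  have "(\<Sum>(C, \<xi>)\<leftarrow>ws. G C \<xi> - C) = b - B - d"
    using good d by (auto simp: good_state_def ws_def G0)
  with upd(2) have sum_us: "(\<Sum>(C, \<xi>)\<leftarrow>us. G C \<xi> - C) = b + S - d - B"
    by simp
  show thesis
  proof (rule that[of us])
    show "good_state b' vs'"
    proof (cases "b' = 0")
      case True
      then show ?thesis using vs' good_state_init by simp
    next
      case False
      \<comment> \<open>A purchase above \<open>S\<close> is forced by the demand, covers exactly
        the deficit, and hence leaves the inventory empty.\<close>
      then have "x = S" using x b' upd(5) by (auto simp: max_def split: if_splits)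
      then show ?thesis
        using upd(1) sum_us False vs' b' x unfolding good_state_def by auto
    qed
    show "0 \<le> x" "b' = b + x - d" using x b' by auto
    have "p * (x - S) \<le> pmax * (x - S)"
      using p x by (intro mult_right_mono) auto
    moreover have "capped ws \<xi>0 = capped vs \<xi>0 + d * \<xi>0"
      by (simp add: capped_ws)
    \<comment> \<open>The storage opened for \<open>d\<close> adds \<open>d * \<xi>0\<close> to the
      dual value, worth \<open>pmax * d\<close> to the algorithm; this is where the demand term on
      the right comes from.\<close>
    moreover have "\<alpha> * \<xi>0 = pmax" using \<alpha>_gt by simp
    then have "\<alpha> * (d * \<xi>0) = pmax * d" by (metis mult.commute mult.left_commute)
    ultimately show "p * x \<le> \<alpha> * (capped us \<xi>0 - capped vs \<xi>0) + pmax * (x - d)"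
      using upd(4) by (simp add: algebra_simps)
    show "capped us q = capped vs (min p q) + d * min p q" if "q \<le> \<xi>0" for q
      using that by (auto simp: upd(3) capped_ws min_def)
    show "vs' = us \<or> vs' = [(B, \<xi>0)]" using vs' by simp
  qed
qed

subsection \<open>Competitiveness of BatMan\<close>

abbreviation "bm \<equiv> batman G \<xi>0 B"

text \<open>The last conjunct is weak duality for the offline problem with the dual prices of the
  current phase capped at \<open>q\<close>; \<open>K\<close> collects the dual value of the completed phases.
  Quantifying over \<open>q\<close> makes it inductive: a price \<open>p\<close> replaces \<open>q\<close> by \<open>min p q\<close>.\<close>

lemma batman_invariant:
  assumes "valid_input pmin pmax \<omega>"
  shows "\<exists>K b vs. batman_run G \<xi>0 B \<omega> = (b, vs) \<and> good_state b vs
    \<and> b = inventory \<omega> (decisions bm \<omega>) (length \<omega>) \<and> feasible B \<omega> (decisions bm \<omega>)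
    \<and> cost \<omega> (decisions bm \<omega>) \<le> \<alpha> * (K + capped vs \<xi>0) + pmax * (b - B)
    \<and> (\<forall>x. feasible B \<omega> x \<longrightarrow> (\<forall>q\<in>{0..\<xi>0}.
          K + capped vs q - (B - inventory \<omega> x (length \<omega>)) * q \<le> cost \<omega> x))"
  using assms
proof (induction \<omega> rule: rev_induct)
  case Nil
  have "capped [(B, \<xi>0)] q = B * min \<xi>0 q" for q
    by (simp add: capped_def)
  then show ?case
    using good_state_init \<alpha>_gt
    by (intro exI[of _ 0]) (auto simp: batman_run_def batman_init_def)
next
  case (snoc s \<omega>)
  obtain p d where s: "s = (p, d)" by fastforce
  have valid: "valid_input pmin pmax \<omega>" and p: "p \<in> {pmin..pmax}" and d: "0 \<le> d"
    using snoc.prems by (auto simp: valid_input_snoc s)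
  let ?x = "decisions bm \<omega>"
  let ?y = "inventory \<omega> ?x (length \<omega>)"
  from snoc.IH[OF valid] obtain K b vs where run: "batman_run G \<xi>0 B \<omega> = (b, vs)"
    and good: "good_state b vs" and b: "b = ?y" and feas: "feasible B \<omega> ?x"
    and alg: "cost \<omega> ?x \<le> \<alpha> * (K + capped vs \<xi>0) + pmax * (b - B)"
    and opt: "\<And>x q. feasible B \<omega> x \<Longrightarrow> q \<in> {0..\<xi>0} \<Longrightarrow>
        K + capped vs q - (B - inventory \<omega> x (length \<omega>)) * q \<le> cost \<omega> x"
    by blast
  obtain x b' vs' where step: "batman_step G \<xi>0 B (b, vs) (p, d) = (x, (b', vs'))"
    by (metis prod.exhaust)
  from batman_step_good[OF good p d step] obtain us where good': "good_state b' vs'"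
    and x0: "0 \<le> x" and b': "b' = b + x - d"
    and px: "p * x \<le> \<alpha> * (capped us \<xi>0 - capped vs \<xi>0) + pmax * (x - d)"
    and us: "\<And>q. q \<le> \<xi>0 \<Longrightarrow> capped us q = capped vs (min p q) + d * min p q"
    and vs': "vs' = us \<or> vs' = [(B, \<xi>0)]"
    by blast
  have bm: "bm (\<omega> @ [s]) = x"
    by (simp add: batman_def run step s)
  note dec = decisions_snoc[where A = bm and \<omega> = \<omega> and s = s, unfolded bm, unfolded s]
  have run': "batman_run G \<xi>0 B (\<omega> @ [s]) = (b', vs')"
    using run step by (simp add: batman_run_def s)
  have cost': "cost (\<omega> @ [s]) (decisions bm (\<omega> @ [s])) \<le> \<alpha> * (K + capped us \<xi>0) + pmax * (b' - B)"
    using alg px by (simp add: cost_snoc dec s b' algebra_simps)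
  have opt': "K + capped us q - (B - inventory (\<omega> @ [s]) z (length (\<omega> @ [s]))) * q \<le> cost (\<omega> @ [s]) z"
    if feas: "feasible B (\<omega> @ [s]) z" and q: "q \<in> {0..\<xi>0}" for z q
  proof -
    define y z' y' where "y = inventory \<omega> z (length \<omega>)" and "z' = z (Suc (length \<omega>))"
      and "y' = inventory (\<omega> @ [s]) z (length (\<omega> @ [s]))"
    have y': "y' = y + z' - d"
      by (simp add: y'_def y_def z'_def inventory_append s)
    have z: "feasible B \<omega> z" "0 \<le> z'" "y' \<le> B"
      using feas by (auto simp: feasible_snoc y'_def z'_def inventory_append)
    have "K + capped vs (min p q) - (B - y) * min p q \<le> cost \<omega> z"
      unfolding y_def using q p pmin_pos by (intro opt z(1)) auto
    moreover have "min p q * z' \<le> p * z'"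
      using z by (intro mult_right_mono) auto
    moreover have "(B - y') * min p q \<le> (B - y') * q"
      using z by (intro mult_left_mono) auto
    ultimately have "K + capped us q - (B - y') * q \<le> cost \<omega> z + p * z'"
      using q by (simp add: us y' algebra_simps)
    then show ?thesis by (simp add: cost_snoc z'_def y'_def s)
  qed
  have feas': "feasible B (\<omega> @ [s]) (decisions bm (\<omega> @ [s]))"
    using feas good' good_state_le[OF good'] b x0 b'
    by (auto simp: feasible_snoc dec s good_state_def)
  have inv': "b' = inventory (\<omega> @ [s]) (decisions bm (\<omega> @ [s])) (length (\<omega> @ [s]))"
    using b b' by (simp add: inventory_append dec s)
  from vs' show ?case
  proof
    assume "vs' = us"
    then show ?thesis
      using run' good' inv' feas' cost' opt' by (intro exI[of _ K] exI[of _ b'] exI[of _ us]) auto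
  next
    assume reset: "vs' = [(B, \<xi>0)]"
    \<comment> \<open>The fresh storage is worth \<open>B * \<xi>0\<close> at the cap
      \<open>\<xi>0\<close>; taking this amount out of \<open>K\<close> keeps the dual value there
      unchanged.\<close>
    define K' where "K' = K + capped us \<xi>0 - B * \<xi>0"
    have cap: "capped vs' q = B * q" if "q \<le> \<xi>0" for q
      using that by (simp add: reset capped_def)
    have "K' + capped vs' q - (B - inventory (\<omega> @ [s]) z (length (\<omega> @ [s]))) * q \<le> cost (\<omega> @ [s]) z"
      if z: "feasible B (\<omega> @ [s]) z" and q: "q \<in> {0..\<xi>0}" for z q
    proof -
      define y' where "y' = inventory (\<omega> @ [s]) z (length (\<omega> @ [s]))"
      have "0 \<le> y'"
        using feasible_inventory[OF z] B_pos by (simp add: y'_def)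
      \<comment> \<open>The dual bound is now \<open>K' + y' * q\<close>, nondecreasing in
        \<open>q\<close>, so the cap \<open>\<xi>0\<close> settles all smaller ones.\<close>
      then have "y' * q \<le> y' * \<xi>0"
        using q by (intro mult_left_mono) auto
      moreover have "K + capped us \<xi>0 - (B - y') * \<xi>0 \<le> cost (\<omega> @ [s]) z"
        unfolding y'_def using q by (intro opt' z) auto
      moreover have "capped vs' q = B * q" using cap q by simp
      ultimately show ?thesis
        unfolding y'_def[symmetric] K'_def left_diff_distrib by linarith
    qed
    moreover have "K' + capped vs' \<xi>0 = K + capped us \<xi>0"
      by (simp add: cap K'_def)
    ultimately show ?thesis
      using run' good' inv' feas' cost'
      by (intro exI[of _ K'] exI[of _ b'] exI[of _ vs']) auto
  qed
qed

lemma batman_online: "online_algorithm pmin pmax B bm"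
  unfolding online_algorithm_def using batman_invariant by blast

lemma batman_competitive: "competitive pmin pmax B \<alpha> bm"
  unfolding competitive_def
proof (intro exI[of _ "pmax * B"] conjI allI impI)
  show "0 \<le> pmax * B" using pmax_pos B_pos by simp
next
  fix \<omega> assume valid: "valid_input pmin pmax \<omega>"
  let ?c = "cost \<omega> (decisions bm \<omega>)"
  from batman_invariant[OF valid] obtain K b vs where "batman_run G \<xi>0 B \<omega> = (b, vs)"
    and good: "good_state b vs" and "b = inventory \<omega> (decisions bm \<omega>) (length \<omega>)"
    and "feasible B \<omega> (decisions bm \<omega>)"
    and alg: "?c \<le> \<alpha> * (K + capped vs \<xi>0) + pmax * (b - B)"
    and opt: "\<And>x q. feasible B \<omega> x \<Longrightarrow> q \<in> {0..\<xi>0} \<Longrightarrow>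
        K + capped vs q - (B - inventory \<omega> x (length \<omega>)) * q \<le> cost \<omega> x"
    by blast
  have "(?c - pmax * B) / \<alpha> \<le> cost \<omega> x" if x: "feasible B \<omega> x" for x
  proof -
    define y where "y = inventory \<omega> x (length \<omega>)"
    have "0 \<le> y" using feasible_inventory[OF x] B_pos by (simp add: y_def)
    then have "0 \<le> pmax * y" using pmax_pos by simp
    moreover have "K + capped vs \<xi>0 - (B - y) * \<xi>0 \<le> cost \<omega> x"
      unfolding y_def using pmin_pos pmin_less by (intro opt x) auto
    then have "\<alpha> * (K + capped vs \<xi>0 - (B - y) * \<xi>0) \<le> \<alpha> * cost \<omega> x"
      using \<alpha>_gt by (intro mult_left_mono) auto
    moreover have "\<alpha> * ((B - y) * \<xi>0) = (B - y) * pmax" using \<alpha>_gt by simp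
    moreover have "pmax * b \<le> pmax * B"
      using good_state_le[OF good] pmax_pos by simp
    ultimately have "?c \<le> \<alpha> * cost \<omega> x + pmax * B"
      using alg unfolding right_diff_distrib left_diff_distrib by (smt (verit) mult.commute)
    then show ?thesis using \<alpha>_gt by (simp add: field_simps)
  qed
  then have "(?c - pmax * B) / \<alpha> \<le> opt_cost B \<omega>"
    using valid B_pos by (intro opt_cost_ge) auto
  then show "?c \<le> \<alpha> * opt_cost B \<omega> + pmax * B"
    using \<alpha>_gt by (simp add: field_simps)
qed

end

subsection \<open>The adversary\<close>

text \<open>Summation by parts: the weights \<open>q\<close> grow, so a surplus over
  \<open>H\<close> saves no more units later than it has cost.\<close>

lemma sum_ge_of_weighted_partial_sums:
  fixes q X H :: "nat \<Rightarrow> real"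
  assumes "\<And>k. 0 < q k" and "\<And>k. q k \<le> q (Suc k)"
    and "\<And>j. j \<le> n \<Longrightarrow> H j \<le> (\<Sum>k\<le>j. q k * X k)"
  shows "H 0 / q 0 + (\<Sum>k<n. (H (Suc k) - H k) / q (Suc k)) \<le> (\<Sum>k\<le>n. X k)"
proof -
  define D where "D j = (\<Sum>k\<le>j. q k * X k) - H j" for j
  have D: "0 \<le> D j" if "j \<le> n" for j
    using assms(3)[OF that] by (simp add: D_def)
  \<comment> \<open>Strengthened for induction by the surplus \<open>D m\<close>, converted to units
    at the current weight.\<close>
  have "H 0 / q 0 + (\<Sum>k<m. (H (Suc k) - H k) / q (Suc k)) \<le> (\<Sum>k\<le>m. X k) - D m / q m"
    if "m \<le> n" for m
    using that
  proof (induction m)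
    case 0
    then show ?case
      using assms(1)[of 0] by (simp add: D_def field_simps)
  next
    case (Suc m)
    have "D m / q (Suc m) \<le> D m / q m"
      using assms(1,2) D Suc.prems by (intro divide_left_mono) auto
    moreover have "D (Suc m) = D m + q (Suc m) * X (Suc m) - (H (Suc m) - H m)"
      by (simp add: D_def)
    then have "D (Suc m) / q (Suc m) = D m / q (Suc m) + X (Suc m) - (H (Suc m) - H m) / q (Suc m)"
      using assms(1)[of "Suc m"] by (simp add: add_divide_distrib diff_divide_distrib)
    ultimately show ?case
      using Suc by simp
  qed
  from this[of n] show ?thesis
    using D[of n] assms(1)[of n] by (smt (verit) divide_nonneg_pos order_refl)
qed

context batman_setting
begin

text \<open>With \<open>u = 1 / \<alpha>\<close>, \<open>full\<close> reads
  \<open>exp u * (1 - u) = 1 - pmin / pmax\<close>, and \<open>exp s * (1 - s)\<close> strictly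
  decreases on the unit interval. At \<open>c = \<alpha>\<close> there would be equality.\<close>

lemma log_ratio_gt:
  assumes "1 < c" and "c < \<alpha>"
  shows "1 < c * ln ((pmax - pmin) / (pmax - pmax / c))"
proof -
  define u v where "u = 1 / \<alpha>" and "v = 1 / c"
  have uv: "0 < u" "u < v" "v < 1"
    using assms \<alpha>_gt by (auto simp: u_def v_def field_simps)
  have "1 - v < 1 - v + u * (v - u)"
    using uv by simp
  also have "\<dots> = (1 - u) * (1 + (u - v))"
    by (simp add: algebra_simps)
  also have "\<dots> \<le> (1 - u) * exp (u - v)"
    using uv by (intro mult_left_mono exp_ge_add_one_self) auto
  finally have "exp v < exp u * (1 - u) / (1 - v)"
    using uv by (simp add: exp_diff field_simps)
  also have "exp u * (1 - u) = 1 - pmin / pmax"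
    using full \<alpha>_gt by (simp add: u_def field_simps)
  also have "(1 - pmin / pmax) / (1 - v) = (pmax - pmin) / (pmax - pmax / c)"
    using uv pmax_pos assms by (simp add: v_def field_simps)
  finally have "v < ln ((pmax - pmin) / (pmax - pmax / c))"
    by (metis exp_gt_zero exp_less_cancel_iff exp_ln order_less_trans)
  then show ?thesis
    using assms by (simp add: v_def field_simps)
qed

text \<open>The prices descend from \<open>pmax / c\<close> to \<open>pmin\<close> along a geometric grid of \<open>pmax - p\<close>.
  Amounts \<open>X\<close> violating the conclusion would keep the algorithm \<open>c\<close>-competitive at every
  stopping point, but would add up to more than \<open>B\<close>.\<close>

lemma descending_prices:
  assumes "1 < c" and "c < \<alpha>"
  obtains N :: nat and P and \<delta> where "0 < \<delta>" and "\<forall>k\<le>N. P k \<in> {pmin..pmax}"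
    and "\<forall>X. (\<Sum>k\<le>N. X k) \<le> B \<longrightarrow>
      (\<exists>j\<le>N. (\<Sum>k\<le>j. (pmax - P k) * X k) \<le> B * (pmax - c * P j) - \<delta>)"
proof -
  define a where "a = pmax - pmax / c"
  define L where "L = ln ((pmax - pmin) / a)"
  have a: "0 < a" "c * a = pmax * (c - 1)"
    using assms pmax_pos by (auto simp: a_def field_simps)
  have cL: "1 < c * L"
    using log_ratio_gt[OF assms] by (simp add: L_def a_def)
  then have L: "0 < L"
    using assms by (metis less_trans mult_pos_pos zero_less_mult_pos zero_less_one)
  have pmin: "pmin < pmax"
    using pmin_less \<xi>0_less by simp
  \<comment> \<open>As the grid is refined, \<open>c * N * (1 - \<rho>)\<close> tends to
    \<open>c * L\<close>; this \<open>N\<close> makes it exceed 1 already, through the bound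
    \<open>N * L / (N + L)\<close> on \<open>N * (1 - \<rho>)\<close>.\<close>
  obtain N :: nat where N: "L / (c * L - 1) < N"
    using reals_Archimedean2 by blast
  have N0: "0 < real N"
    using N L cL by (smt (verit) divide_pos_pos)
  define \<rho> where "\<rho> = exp (- L / N)"
  have "1 + L / N \<le> exp (L / N)"
    by (rule exp_ge_add_one_self)
  moreover have "0 < 1 + L / N"
    using L N0 by (simp add: add_pos_nonneg)
  ultimately have "\<rho> \<le> 1 / (1 + L / N)"
    by (simp add: \<rho>_def exp_minus inverse_eq_divide frac_le)
  also have "\<dots> = N / (N + L)"
    using N0 by (simp add: field_simps)
  finally have "L / (N + L) \<le> 1 - \<rho>"
    using N0 L by (simp add: field_simps)
  then have "c * N * (L / (N + L)) \<le> c * N * (1 - \<rho>)"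
    using assms N0 by (intro mult_left_mono) auto
  moreover have "L < N * (c * L - 1)"
    using N cL by (simp add: field_simps)
  then have "1 < c * N * (L / (N + L))"
    using N0 L by (simp add: field_simps)
  ultimately have gap: "1 < c * N * (1 - \<rho>)" by linarith
  \<comment> \<open>Half of the gap, so that an error of \<open>\<delta> / a\<close> in the total
    purchase still leaves it above \<open>B\<close>.\<close>
  define \<delta> where "\<delta> = a * B * (c * N * (1 - \<rho>) - 1) / 2"
  have \<delta>: "0 < \<delta>"
    using a gap B_pos by (simp add: \<delta>_def)
  define q where "q k = a * exp (L * k / N)" for k :: nat
  have q_Suc: "q k = \<rho> * q (Suc k)" for k
    by (simp add: q_def \<rho>_def flip: exp_add) (use N0 in \<open>simp add: field_simps\<close>)
  have q_pos: "0 < q k" for k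
    using a by (simp add: q_def)
  have q_mono: "mono q"
    using a L by (auto simp: q_def intro!: monoI divide_right_mono mult_left_mono)
  have q_0: "q 0 = a" by (simp add: q_def)
  have q_N: "q N = pmax - pmin"
    using N0 a pmin by (simp add: q_def L_def)
  show thesis
  proof (rule that[of \<delta> N "\<lambda>k. pmax - q k"]; (intro allI impI)?)
    show "pmax - q k \<in> {pmin..pmax}" if "k \<le> N" for k
      using monoD[OF q_mono that] q_N q_pos[of k] by auto
    fix X :: "nat \<Rightarrow> real"
    assume X: "(\<Sum>k\<le>N. X k) \<le> B"
    define H where "H j = B * (pmax - c * (pmax - q j)) - \<delta>" for j
    show "\<exists>j\<le>N. (\<Sum>k\<le>j. (pmax - (pmax - q k)) * X k) \<le> B * (pmax - c * (pmax - q j)) - \<delta>"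
    proof (rule ccontr)
      assume "\<not> ?thesis"
      then have "H j \<le> (\<Sum>k\<le>j. q k * X k)" if "j \<le> N" for j
        using that by (fastforce simp: H_def not_le)
      then have "H 0 / q 0 + (\<Sum>k<N. (H (Suc k) - H k) / q (Suc k)) \<le> (\<Sum>k\<le>N. X k)"
        using q_pos q_mono by (intro sum_ge_of_weighted_partial_sums) (auto simp: mono_def)
      \<comment> \<open>On the geometric grid each increment of \<open>H\<close> is the same
        multiple of \<open>q (Suc k)\<close>, so all summands agree.\<close>
      moreover have "(H (Suc k) - H k) / q (Suc k) = B * c * (1 - \<rho>)" for k
      proof -
        have "H (Suc k) - H k = B * c * (1 - \<rho>) * q (Suc k)"
          by (simp add: H_def q_Suc[of k] algebra_simps)
        then show ?thesis using q_pos[of "Suc k"] by simp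
      qed
      \<comment> \<open>The grid starts at the price \<open>pmax / c\<close>, where
        \<open>pmax - c * p\<close> vanishes.\<close>
      moreover have "H 0 = - \<delta>"
      proof -
        have "pmax - c * (pmax - q 0) = 0"
          using a(2) by (simp add: q_0 algebra_simps)
        then show ?thesis by (simp add: H_def)
      qed
      ultimately have "N * (B * c * (1 - \<rho>)) - \<delta> / a \<le> B"
        using X q_0 by simp
      moreover have "\<delta> / a = B * (c * N * (1 - \<rho>) - 1) / 2"
        using a by (simp add: \<delta>_def)
      moreover have "0 < B * (c * N * (1 - \<rho>) - 1)"
        using gap B_pos by simp
      moreover have "N * (B * c * (1 - \<rho>)) = B * (c * N * (1 - \<rho>) - 1) + B"
        by (simp add: algebra_simps)
      ultimately show False by linarith
    qed
  qed (fact \<delta>)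
qed

end

text \<open>Keeps only the final inventory and the cost of an offline plan, so that plans can be
  extended slot by slot; on valid inputs an attainable cost bounds \<open>opt_cost\<close> from
  above.\<close>

definition attainable :: "real \<Rightarrow> slot list \<Rightarrow> real \<Rightarrow> real \<Rightarrow> bool" where
  "attainable B \<omega> y C \<longleftrightarrow>
     (\<exists>x. feasible B \<omega> x \<and> inventory \<omega> x (length \<omega>) = y \<and> cost \<omega> x = C)"

lemma attainable_snoc:
  assumes "attainable B \<omega> y C" and "0 \<le> z" and "y + z - d \<in> {0..B}"
  shows "attainable B (\<omega> @ [(p, d)]) (y + z - d) (C + p * z)"
proof -
  from assms(1) obtain x where x: "feasible B \<omega> x" "inventory \<omega> x (length \<omega>) = y" "cost \<omega> x = C"
    by (auto simp: attainable_def)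
  define x' where "x' = x(Suc (length \<omega>) := z)"
  have "x' t = x t" if "t \<in> {1..length \<omega>}" for t
    using that by (simp add: x'_def)
  note cong = plan_cong[OF this]
  have z: "x' (Suc (length \<omega>)) = z" by (simp add: x'_def)
  have y: "inventory \<omega> x' (length \<omega>) = y" using cong(3) x(2) by simp
  show ?thesis
    unfolding attainable_def
    by (rule exI[of _ x']) (use assms x cong z y in \<open>auto simp: feasible_snoc cost_snoc inventory_append\<close>)
qed

lemma attainable_no_demand:
  assumes "attainable B \<omega> y C" and "y \<in> {0..B}"
  shows "attainable B (\<omega> @ map (\<lambda>k. (P k, 0)) [0..<j]) y C"
proof (induction j)
  case (Suc j)
  then show ?case
    using attainable_snoc[OF Suc, of 0 0 "P j"] assms(2) by simp
qed (use assms in simp)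

lemma decisions_no_demand:
  fixes \<omega> :: "slot list" and P :: "nat \<Rightarrow> real" and A :: policy
  defines "\<omega>s \<equiv> \<lambda>j. \<omega> @ map (\<lambda>k. (P k, 0)) [0..<j]"
  shows "inventory (\<omega>s j) (decisions A (\<omega>s j)) (length (\<omega>s j)) =
      inventory \<omega> (decisions A \<omega>) (length \<omega>) + (\<Sum>k<j. A (\<omega>s (Suc k)))"
    and "cost (\<omega>s j) (decisions A (\<omega>s j)) =
      cost \<omega> (decisions A \<omega>) + (\<Sum>k<j. P k * A (\<omega>s (Suc k)))"
proof -
  have \<omega>s_Suc: "\<omega>s (Suc j) = \<omega>s j @ [(P j, 0)]" for j
    by (simp add: \<omega>s_def)
  have "inventory (\<omega>s j) (decisions A (\<omega>s j)) (length (\<omega>s j)) =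
      inventory \<omega> (decisions A \<omega>) (length \<omega>) + (\<Sum>k<j. A (\<omega>s (Suc k))) \<and>
    cost (\<omega>s j) (decisions A (\<omega>s j)) =
      cost \<omega> (decisions A \<omega>) + (\<Sum>k<j. P k * A (\<omega>s (Suc k)))"
  proof (induction j)
    case 0
    then show ?case by (simp add: \<omega>s_def)
  next
    case (Suc j)
    then show ?case
      unfolding sum.lessThan_Suc \<omega>s_Suc by (simp add: cost_snoc inventory_append decisions_snoc)
  qed
  then show "inventory (\<omega>s j) (decisions A (\<omega>s j)) (length (\<omega>s j)) =
      inventory \<omega> (decisions A \<omega>) (length \<omega>) + (\<Sum>k<j. A (\<omega>s (Suc k)))"
    and "cost (\<omega>s j) (decisions A (\<omega>s j)) =
      cost \<omega> (decisions A \<omega>) + (\<Sum>k<j. P k * A (\<omega>s (Suc k)))" by auto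
qed

context batman_setting
begin

lemma valid_input_no_demand:
  assumes "valid_input pmin pmax \<omega>" and "\<And>k. k < j \<Longrightarrow> P k \<in> {pmin..pmax}"
  shows "valid_input pmin pmax (\<omega> @ map (\<lambda>k. (P k, 0)) [0..<j])"
  using assms(2)
proof (induction j)
  case (Suc j)
  then have "valid_input pmin pmax ((\<omega> @ map (\<lambda>k. (P k, 0)) [0..<j]) @ [(P j, 0)])"
    unfolding valid_input_snoc by auto
  then show ?case by simp
qed (use assms in simp)

text \<open>Inventory left over by the algorithm is credited at \<open>pmax\<close>, so that stocking up during the
  final slot of an adversarial phase does not pay.\<close>

definition net_cost :: "policy \<Rightarrow> slot list \<Rightarrow> real" where
  "net_cost A \<omega> =
     cost \<omega> (decisions A \<omega>) - pmax * inventory \<omega> (decisions A \<omega>) (length \<omega>)"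

text \<open>The offline player waits for the price \<open>P j\<close>, buys \<open>B\<close> there
  and serves the final demand from it, paying \<open>P j * B\<close>. For the algorithm a unit
  bought at \<open>P k\<close> lowers the net cost by \<open>pmax - P k\<close>, and
  \<open>stop\<close> limits the total of these savings.\<close>

lemma adversary_phase:
  fixes P :: "nat \<Rightarrow> real"
  assumes A: "online_algorithm pmin pmax B A" and valid: "valid_input pmin pmax \<omega>"
    and att: "attainable B \<omega> 0 C"
    and P: "\<forall>k\<le>N. P k \<in> {pmin..pmax}"
    and stop: "\<forall>X. (\<Sum>k\<le>N. X k) \<le> B \<longrightarrow>
      (\<exists>j\<le>N. (\<Sum>k\<le>j. (pmax - P k) * X k) \<le> B * (pmax - c * P j) - \<delta>)"
  obtains \<omega>' C' where "valid_input pmin pmax \<omega>'" and "attainable B \<omega>' 0 C'"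
    and "net_cost A \<omega> + c * (C' - C) + \<delta> \<le> net_cost A \<omega>'"
proof -
  define \<omega>s where "\<omega>s j = \<omega> @ map (\<lambda>k. (P k, 0)) [0..<j]" for j
  define X where "X k = A (\<omega>s (Suc k))" for k
  note run = decisions_no_demand[of \<omega> P _ A, folded \<omega>s_def, folded X_def]
  have valid_\<omega>s: "valid_input pmin pmax (\<omega>s j)" if "j \<le> Suc N" for j
    unfolding \<omega>s_def using that P by (intro valid_input_no_demand valid) auto
  have inv: "inventory \<omega>' (decisions A \<omega>') (length \<omega>') \<in> {0..B}" if "valid_input pmin pmax \<omega>'" for \<omega>'
    using that A B_pos by (intro feasible_inventory) (auto simp: online_algorithm_def)
  \<comment> \<open>Nothing is consumed along the full descent, so all purchases must fit into the
    capacity. Stopping at \<open>j\<close> does not change those made up to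
    \<open>j\<close>.\<close>
  have "(\<Sum>k\<le>N. X k) \<le> B"
    using inv[OF valid_\<omega>s[of "Suc N"]] inv[OF valid] by (simp add: run lessThan_Suc_atMost)
  with stop obtain j where j: "j \<le> N"
    and le: "(\<Sum>k\<le>j. (pmax - P k) * X k) \<le> B * (pmax - c * P j) - \<delta>" by blast
  define \<omega>' where "\<omega>' = \<omega>s (Suc j) @ [(pmax, B)]"
  show thesis
  proof (rule that[of \<omega>' "C + P j * B"])
    show "valid_input pmin pmax \<omega>'"
      unfolding \<omega>'_def valid_input_snoc
      using valid_\<omega>s[of "Suc j"] j B_pos pmin_less \<xi>0_less by auto
    have "attainable B (\<omega>s j) 0 C"
      unfolding \<omega>s_def using att B_pos by (intro attainable_no_demand) auto
    from attainable_snoc[OF this, of B 0 "P j"] have "attainable B (\<omega>s (Suc j)) B (C + P j * B)"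
      using B_pos by (simp add: \<omega>s_def)
    from attainable_snoc[OF this, of 0 B pmax] show "attainable B \<omega>' 0 (C + P j * B)"
      using B_pos by (simp add: \<omega>'_def)
    \<comment> \<open>Whatever is bought in the final slot costs \<open>pmax\<close> and is credited
      at \<open>pmax\<close>; only the demand counts.\<close>
    have "net_cost A \<omega>' = net_cost A (\<omega>s (Suc j)) + pmax * B"
      by (simp add: net_cost_def \<omega>'_def cost_snoc inventory_append decisions_snoc algebra_simps)
    also have "net_cost A (\<omega>s (Suc j)) = net_cost A \<omega> - (\<Sum>k\<le>j. (pmax - P k) * X k)"
      unfolding net_cost_def run lessThan_Suc_atMost
      by (simp add: sum_subtractf sum_distrib_left algebra_simps)
    finally show "net_cost A \<omega> + c * (C + P j * B - C) + \<delta> \<le> net_cost A \<omega>'"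
      using le by (simp add: algebra_simps)
  qed
qed

lemma not_competitive_below:
  assumes A: "online_algorithm pmin pmax B A" and c: "1 < c" "c < \<alpha>"
  shows "\<not> competitive pmin pmax B c A"
proof
  assume "competitive pmin pmax B c A"
  then obtain K where K: "\<And>\<omega>. valid_input pmin pmax \<omega> \<Longrightarrow>
      cost \<omega> (decisions A \<omega>) \<le> c * opt_cost B \<omega> + K"
    unfolding competitive_def by blast
  obtain N :: nat and P and \<delta> where \<delta>: "0 < \<delta>" and P: "\<forall>k\<le>N. P k \<in> {pmin..pmax}"
    and stop: "\<forall>X. (\<Sum>k\<le>N. X k) \<le> B \<longrightarrow>
      (\<exists>j\<le>N. (\<Sum>k\<le>j. (pmax - P k) * X k) \<le> B * (pmax - c * P j) - \<delta>)"
    by (rule descending_prices[OF c])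
  have phases: "\<exists>\<omega> C. valid_input pmin pmax \<omega> \<and> attainable B \<omega> 0 C \<and> c * C + n * \<delta> \<le> net_cost A \<omega>"
    for n :: nat
  proof (induction n)
    case 0
    show ?case
      by (intro exI[of _ "[]"] exI[of _ 0]) (auto simp: attainable_def net_cost_def)
  next
    case (Suc n)
    then obtain \<omega> C where \<omega>: "valid_input pmin pmax \<omega>" "attainable B \<omega> 0 C"
      and le: "c * C + n * \<delta> \<le> net_cost A \<omega>" by blast
    obtain \<omega>' C' where "valid_input pmin pmax \<omega>'" "attainable B \<omega>' 0 C'"
      and "net_cost A \<omega> + c * (C' - C) + \<delta> \<le> net_cost A \<omega>'"
      by (rule adversary_phase[OF A \<omega> P stop])
    then show ?case
      using le by (intro exI[of _ \<omega>'] exI[of _ C']) (auto simp: algebra_simps)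
  qed
  obtain n :: nat where n: "K < n * \<delta>"
    using reals_Archimedean3[OF \<delta>] by blast
  obtain \<omega> C where valid: "valid_input pmin pmax \<omega>" and att: "attainable B \<omega> 0 C"
    and le: "c * C + n * \<delta> \<le> net_cost A \<omega>"
    using phases by blast
  have "opt_cost B \<omega> \<le> C"
    using att valid pmin_pos opt_cost_le[of pmin pmax \<omega> B] by (auto simp: attainable_def)
  then have "c * opt_cost B \<omega> \<le> c * C"
    using c by simp
  moreover have "0 \<le> inventory \<omega> (decisions A \<omega>) (length \<omega>)"
    using feasible_inventory[of B \<omega> "decisions A \<omega>"] A valid B_pos
    by (auto simp: online_algorithm_def)
  then have "net_cost A \<omega> \<le> cost \<omega> (decisions A \<omega>)"
    using pmax_pos by (simp add: net_cost_def)
  ultimately show False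
    using K[OF valid] le n by linarith
qed

lemma competitive_mono:
  assumes "competitive pmin pmax B c A" and "c \<le> c'"
  shows "competitive pmin pmax B c' A"
proof -
  have "c * opt_cost B \<omega> \<le> c' * opt_cost B \<omega>" if "valid_input pmin pmax \<omega>" for \<omega>
    using that assms(2) pmin_pos B_pos
    by (intro mult_right_mono opt_cost_ge) (auto intro: cost_nonneg)
  then show ?thesis
    using assms(1) unfolding competitive_def by (meson add_right_mono order_trans)
qed

lemma competitive_ge:
  assumes "online_algorithm pmin pmax B A" and "competitive pmin pmax B c A"
  shows "\<alpha> \<le> c"
proof (rule ccontr)
  assume "\<not> \<alpha> \<le> c"
  \<comment> \<open>\<open>not_competitive_below\<close> needs a ratio above 1, so \<open>c\<close>
    is raised to at least the midpoint of 1 and \<alpha>.\<close>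
  then have "1 < max c ((1 + \<alpha>) / 2)" "max c ((1 + \<alpha>) / 2) < \<alpha>"
    using \<alpha>_gt by (auto simp: max_def)
  then show False
    using not_competitive_below[OF assms(1)] competitive_mono[OF assms(2)] by (meson max.cobounded1)
qed

end

section \<open>The Lambert function and the equation for \<alpha>\<close>

lemma Lambert_W_properties:
  assumes "- exp (- 1) < z" and "z < 0"
  shows "Lambert_W z * exp (Lambert_W z) = z" and "- 1 < Lambert_W z" and "Lambert_W z < 0"
proof -
  \<comment> \<open>On \<open>[-1, 0]\<close> the function runs from \<open>- exp (- 1)\<close> to
    \<open>0\<close>, so \<open>inv_into\<close> meets a genuine preimage; the strict bounds on
    \<open>z\<close> then exclude both endpoints.\<close>
  have "\<exists>w\<ge>- 1. w \<le> 0 \<and> w * exp w = z"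
    using assms by (intro IVT') (auto intro!: continuous_intros)
  then have "z \<in> (\<lambda>w. w * exp w) ` {- 1..}"
    by force
  then have W: "Lambert_W z * exp (Lambert_W z) = z" "Lambert_W z \<in> {- 1..}"
    unfolding Lambert_W_def by (rule f_inv_into_f, rule inv_into_into)
  show "Lambert_W z * exp (Lambert_W z) = z" by fact
  have "Lambert_W z \<noteq> - 1" using W(1) assms(1) by auto
  then show "- 1 < Lambert_W z" using W(2) by auto
  show "Lambert_W z < 0"
    using W(1) assms(2) by (metis exp_gt_zero mult_less_0_iff not_less_iff_gr_or_eq)
qed

text \<open>For \<open>\<alpha> = 1 / (w + 1)\<close> the equation of the Lambert function becomes
  \<open>- w * exp (w + 1) = r\<close>, and \<open>\<alpha> / (\<alpha> - 1) = 1 / (- w)\<close>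
  turns this into \<open>full\<close>.\<close>

lemma batman_setting_Lambert_W:
  fixes pmin pmax B \<theta> \<alpha> :: real
  assumes "0 < pmin" and "pmin < pmax" and "0 < B"
    and \<theta>: "\<theta> = pmax / pmin"
    and \<alpha>: "\<alpha> = inverse (Lambert_W (- ((\<theta> - 1) / (\<theta> * exp 1))) + 1)"
  shows "batman_setting pmin pmax B \<alpha>"
proof -
  define r where "r = 1 - pmin / pmax"
  have r: "0 < r" "r < 1"
    using assms by (auto simp: r_def)
  define w where "w = Lambert_W (- (r * exp (- 1)))"
  have "(\<theta> - 1) / \<theta> = r"
    using assms(1,2) by (simp add: r_def \<theta> field_simps)
  then have "- ((\<theta> - 1) / (\<theta> * exp 1)) = - (r * exp (- 1))"
    by (simp add: exp_minus divide_inverse inverse_mult_distrib mult.assoc)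
  then have \<alpha>w: "\<alpha> = inverse (w + 1)"
    using \<alpha> by (simp only: w_def)
  have "w * exp w = - (r * exp (- 1))" and w: "- 1 < w" "w < 0"
    using Lambert_W_properties[of "- (r * exp (- 1))"] r by (auto simp: w_def)
  then have "- w * (exp w * exp 1) = r"
    by (simp add: exp_minus field_simps)
  then have rw: "- w * exp (w + 1) = r"
    by (simp add: exp_add)
  have inv: "1 / \<alpha> = w + 1" by (simp add: \<alpha>w divide_inverse)
  have "1 < \<alpha>" using w by (simp add: \<alpha>w one_less_inverse)
  show ?thesis
  proof
    show "pmin < pmax / \<alpha>"
    proof -
      \<comment> \<open>Since \<open>w + 1\<close> is positive, \<open>- w < r\<close>, which
        rearranges to \<open>pmin / pmax < w + 1\<close>.\<close>
      have "- w * 1 < - w * exp (w + 1)"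
        using w by (intro mult_strict_left_mono) auto
      then have "pmin / pmax < 1 / \<alpha>"
        unfolding rw inv by (simp add: r_def)
      then show ?thesis
        using assms(1,2) \<open>1 < \<alpha>\<close> by (simp add: field_simps)
    qed
    have "\<alpha> / (\<alpha> - 1) = 1 / (- w)"
      using w by (simp add: \<alpha>w field_simps)
    then show "(1 - pmin / pmax) * (\<alpha> / (\<alpha> - 1)) = exp (1 / \<alpha>)"
      using w unfolding r_def[symmetric] inv by (simp flip: rw)
  qed fact+
qed

theorem theorem1p1:
  fixes pmin pmax B \<theta> \<alpha> :: real
  assumes "0 < pmin" and "pmin < pmax" and "0 < B"
    and "\<theta> = pmax / pmin"
    and "\<alpha> = inverse (Lambert_W (- ((\<theta> - 1) / (\<theta> * exp 1))) + 1)"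
  shows "online_algorithm pmin pmax B (batman (reservation pmax \<alpha>) (pmax / \<alpha>) B)
    \<and> competitive pmin pmax B \<alpha> (batman (reservation pmax \<alpha>) (pmax / \<alpha>) B)
    \<and> \<not> (\<exists>A c. online_algorithm pmin pmax B A \<and> c < \<alpha> \<and> competitive pmin pmax B c A)"
proof -
  interpret batman_setting pmin pmax B \<alpha>
    using assms by (rule batman_setting_Lambert_W)
  show ?thesis
    using batman_online batman_competitive competitive_ge by (meson not_le)
qed

end
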